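(* Let $N,p,q$ be real numbers with $q>p-1>0$, and let $\sigma=-p\,\frac{N-1}{p-1}$. Then there exist explicit (positive, radial) solutions $w$ of the equation $$-(|w'|^{p-2}w')'-\frac{N-1}{r}|w'|^{p-2}w'=-r^{\sigma}w^{q}$$ of the form $$w=\bigl(c\pm d_{p,q,N}\,r^{\frac{p-N}{p-1}}\bigr)^{-\frac{p}{q-p+1}}\quad\text{if } p\ne N,\qquad w=\bigl(c\pm d_N\ln r\bigr)^{-\frac{N}{q-N+1}}\quad\text{if } p=N,$$ where $c>0$ and $$d_{p,q,N}=\frac{(p-1)(q-p+1)}{p(p-N)}\Bigl(\frac{p}{(p-1)(q+1)}\Bigr)^{\frac1p},\qquad d_N=\frac{q-N+1}{N}\Bigl(\frac{N}{(N-1)(q+1)}\Bigr)^{\frac1N}.$$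
   Context: $N$ is not necessarily an integer. The functions $w$ are considered on intervals of $(0,\infty)$ on which the expression in parentheses is positive. *)

theory Defs
  imports "HOL-Analysis.Analysis"
begin

definition nondegenerate_interval :: "real set \<Rightarrow> bool" where
  "nondegenerate_interval I \<longleftrightarrow> is_interval I \<and> interior I \<noteq> {} \<and> I \<subseteq> {0<..}"

(* For p > 1 this is the continuous map s |-> |s|^(p-2) s: at s = 0 it takes the value 0,
   also when p < 2, because of the factor s. *)
definition flux :: "real \<Rightarrow> real \<Rightarrow> real" where
  "flux p s = \<bar>s\<bar> powr (p - 2) * s"

definition sigma :: "real \<Rightarrow> real \<Rightarrow> real" where
  "sigma N p = - p * ((N - 1) / (p - 1))"

(* Pointwise (classical) positive solutions of
     -(|w'|^(p-2) w')' - (N-1)/r |w'|^(p-2) w' = -r^sigma w^q.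
   Derivatives are taken within I, so they are one-sided at end points belonging to I and
   ordinary derivatives when I is open. Here w' is the derivative of w and v' that of
   |w'|^(p-2) w'; both are unique on I because I is nondegenerate. *)
definition positive_solution_on ::
  "real \<Rightarrow> real \<Rightarrow> real \<Rightarrow> real set \<Rightarrow> (real \<Rightarrow> real) \<Rightarrow> bool" where
  "positive_solution_on N p q I w \<longleftrightarrow>
     nondegenerate_interval I \<and>
     (\<forall>r\<in>I. 0 < w r) \<and>
     (\<exists>w' v'. \<forall>r\<in>I.
        (w has_real_derivative w' r) (at r within I) \<and>
        ((\<lambda>t. flux p (w' t)) has_real_derivative v' r) (at r within I) \<and>
        - v' r - (N - 1) / r * flux p (w' r) = - (r powr sigma N p * w r powr q))"

definition d_pqN :: "real \<Rightarrow> real \<Rightarrow> real \<Rightarrow> real" where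
  "d_pqN p q N =
     ((p - 1) * (q - p + 1)) / (p * (p - N)) * (p / ((p - 1) * (q + 1))) powr (1 / p)"

definition d_N :: "real \<Rightarrow> real \<Rightarrow> real" where
  "d_N q N = (q - N + 1) / N * (N / ((N - 1) * (q + 1))) powr (1 / N)"

(* The functions w = u^(-k) are considered on the intervals of (0,oo) on which u > 0;
   the first conjunct says that there are such intervals. *)
definition gives_positive_solutions ::
  "real \<Rightarrow> real \<Rightarrow> real \<Rightarrow> (real \<Rightarrow> real) \<Rightarrow> real \<Rightarrow> bool" where
  "gives_positive_solutions N p q u k \<longleftrightarrow>
     (\<exists>I. nondegenerate_interval I \<and> (\<forall>r\<in>I. 0 < u r)) \<and>
     (\<forall>I. nondegenerate_interval I \<and> (\<forall>r\<in>I. 0 < u r) \<longrightarrow>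
        positive_solution_on N p q I (\<lambda>r. u r powr (- k)))"

end

theory Submission
  imports Defs
begin

text \<open>
  Radial \<open>p\<close>-harmonic functions \<open>u\<close> are those for which \<open>r powr (N - 1) * flux p (u' r)\<close> is constant,
  that is \<open>u' = E * r powr (- (N - 1) / (p - 1))\<close> for some constant \<open>E\<close>. Both
  \<open>c \<plusminus> d * r powr ((p - N) / (p - 1))\<close> and, when \<open>p = N\<close>, \<open>c \<plusminus> d * ln r\<close> are of this kind,
  so one computation covers both cases.

  For \<open>w = u powr (- k)\<close> the quantity \<open>r powr (N - 1) * flux p (w' r)\<close> is a constant times
  \<open>u powr (- (k + 1) * (p - 1))\<close>: the weight \<open>r powr (N - 1)\<close> cancels. Differentiating once more
  brings back one factor \<open>u' = E * r powr (- (N - 1) / (p - 1))\<close>, and after division by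
  \<open>r powr (N - 1)\<close> the total power of \<open>r\<close> is exactly \<open>sigma N p\<close>. The result is a multiple of
  \<open>w powr q\<close> as soon as \<open>(k + 1) * (p - 1) + 1 = k * q\<close>, which determines \<open>k = p / (q - p + 1)\<close>,
  and the requirement that the multiple be \<open>1\<close> determines \<open>\<bar>E\<bar>\<close>, hence \<open>d\<close>. This is
  \<open>negative_power_of_p_harmonic_solves\<close>; the sign of \<open>E\<close> is free, whence the \<open>\<plusminus>\<close>.
\<close>

lemma flux_minus: "flux p (- x) = - flux p x"
  by (simp add: flux_def)

lemma flux_mult: "flux p (x * y) = flux p x * flux p y"
  by (simp add: flux_def abs_mult powr_mult)

lemma flux_pos:
  assumes "x > 0"
  shows "flux p x = x powr (p - 1)"
  using assms by (simp add: flux_def powr_mult_base mult.commute)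

text \<open>
  The two numerical hypotheses on \<open>k\<close> and \<open>E\<close> say that the power of \<open>u\<close> and the constant factor
  produced by the radial \<open>p\<close>-Laplacian are those of \<open>w powr q\<close>.
\<close>

lemma negative_power_of_p_harmonic_solves:
  fixes N p q k E :: real
  assumes p: "p > 1"
    and k: "(k + 1) * (p - 1) + 1 = k * q"
    and E: "(k + 1) * (p - 1) * (flux p (k * E) * E) = 1"
    and I: "nondegenerate_interval I"
    and u_pos: "\<And>r. r \<in> I \<Longrightarrow> 0 < u r"
    and u_deriv: "\<And>r. r \<in> I \<Longrightarrow>
      (u has_real_derivative E * r powr (- (N - 1) / (p - 1))) (at r within I)"
  shows "positive_solution_on N p q I (\<lambda>r. u r powr (- k))"
proof -
  define m where "m = - (N - 1) / (p - 1)"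
  define G where "G = - flux p (k * E)"
  define a where "a = (k + 1) * (p - 1)"
  define w' where "w' r = - (k * E) * (u r powr (- k - 1) * r powr m)" for r
  define v' where "v' r = G * (- a * u r powr (- a - 1) * (E * r powr m) * r powr (1 - N)
      + u r powr (- a) * ((1 - N) * r powr (- N)))" for r
  have r_pos: "0 < r" if "r \<in> I" for r
    using I that by (auto simp: nondegenerate_interval_def)
  have m: "m * (p - 1) = 1 - N"
    using p by (simp add: m_def)
  have du: "(u has_real_derivative E * r powr m) (at r within I)" if "r \<in> I" for r
    using u_deriv[OF that] by (simp add: m_def)
  have u_powr: "((\<lambda>t. u t powr b) has_real_derivative b * u r powr (b - 1) * (E * r powr m))
      (at r within I)" if "r \<in> I" for r b
    by (rule DERIV_chain2[OF has_real_derivative_powr[OF u_pos[OF that]] du[OF that]])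
  have dw: "((\<lambda>r. u r powr (- k)) has_real_derivative w' r) (at r within I)" if "r \<in> I" for r
    using u_powr[OF that, of "- k"] by (simp add: w'_def algebra_simps)
  have flux_w': "flux p (w' r) = G * (u r powr (- a) * r powr (1 - N))" if "r \<in> I" for r
  proof -
    have pos: "0 < u r powr (- k - 1) * r powr m"
      using u_pos[OF that] r_pos[OF that] by simp
    have "flux p (w' r) = G * (u r powr (- k - 1) * r powr m) powr (p - 1)"
      unfolding w'_def flux_mult[of p "- (k * E)"] flux_minus flux_pos[OF pos] G_def by simp
    moreover have "(- k - 1) * (p - 1) = - a"
      by (simp add: a_def algebra_simps)
    ultimately show ?thesis
      using u_pos[OF that] r_pos[OF that] by (simp add: powr_mult powr_powr m)
  qed
  have dv: "((\<lambda>t. flux p (w' t)) has_real_derivative v' r) (at r within I)" if "r \<in> I" for r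
  proof -
    have "((\<lambda>t. t powr (1 - N)) has_real_derivative (1 - N) * r powr (- N)) (at r within I)"
      using has_field_derivative_at_within[OF has_real_derivative_powr[OF r_pos[OF that], of "1 - N"]]
      by simp
    then have "((\<lambda>t. G * (u t powr (- a) * t powr (1 - N))) has_real_derivative v' r)
        (at r within I)"
      unfolding v'_def
      by (rule DERIV_cmult[OF DERIV_cong[OF DERIV_mult[OF u_powr[OF that]]]])
         (simp add: algebra_simps)
    then show ?thesis
      by (rule has_field_derivative_transform_within[OF _ zero_less_one that]) (simp add: flux_w')
  qed
  have eq: "- v' r - (N - 1) / r * flux p (w' r)
      = - (r powr sigma N p * (u r powr (- k)) powr q)" if "r \<in> I" for r
  proof -
    have r: "0 < r" using r_pos[OF that] .
    have shift: "r powr (1 - N) = r * r powr (- N)"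
      using r powr_mult_base[of r "- N"] by simp
    have const: "a * G * E = - 1"
      using E by (simp add: a_def G_def algebra_simps)
    have "m + (1 - N) = sigma N p"
      using p by (simp add: m_def sigma_def divide_simps) (simp add: algebra_simps)
    then have r_exp: "r powr m * r powr (1 - N) = r powr sigma N p"
      by (simp flip: powr_add)
    have u_exp: "u r powr (- a - 1) = (u r powr (- k)) powr q"
      using k by (simp add: a_def powr_powr algebra_simps)
    \<comment> \<open>The lower order term cancels the part of \<open>v'\<close> where the weight is differentiated.\<close>
    have "- v' r - (N - 1) / r * flux p (w' r)
        = (a * G * E) * u r powr (- a - 1) * (r powr m * r powr (1 - N))"
      using r unfolding v'_def flux_w'[OF that] shift by (simp add: field_simps)
    then show ?thesis
      by (simp add: const r_exp u_exp)
  qed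
  show ?thesis
    unfolding positive_solution_on_def
  proof (intro conjI exI ballI)
    fix r
    assume r: "r \<in> I"
    show "0 < u r powr (- k)"
      using u_pos[OF r] by simp
  qed (use I dw dv eq in blast)+
qed

lemma positive_near_point_interval:
  fixes u :: "real \<Rightarrow> real"
  assumes "r0 > 0" "0 < u r0" "isCont u r0"
  shows "\<exists>I. nondegenerate_interval I \<and> (\<forall>r\<in>I. 0 < u r)"
proof -
  have "\<forall>\<^sub>F r in nhds r0. 0 < u r"
    using assms(2,3) by (intro order_tendstoD(1)) (auto simp: isCont_def tendsto_at_iff_tendsto_nhds)
  moreover have "\<forall>\<^sub>F r in nhds r0. 0 < r"
    using assms(1) by (rule order_tendstoD(1)[OF filterlim_ident])
  ultimately have "\<forall>\<^sub>F r in nhds r0. 0 < u r \<and> 0 < r"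
    by (rule eventually_conj)
  then obtain e where e: "e > 0" "\<And>r. dist r r0 < e \<Longrightarrow> 0 < u r \<and> 0 < r"
    by (auto simp: eventually_nhds_metric)
  have "nondegenerate_interval (ball r0 e)"
    using e by (auto simp: nondegenerate_interval_def is_interval_ball_real dist_commute)
  with e show ?thesis
    by (intro exI[of _ "ball r0 e"]) (auto simp: dist_commute)
qed

text \<open>
  For the exponent \<open>k = p / (q - p + 1)\<close> the condition on the slope \<open>E\<close> reads
  \<open>\<bar>k * E\<bar> powr p = p / ((p - 1) * (q + 1))\<close>, because \<open>(k + 1) / k = (q + 1) / p\<close>.
\<close>

lemma gives_positive_solutions_of_slope:
  fixes N p q s :: real
  defines "E \<equiv> s * ((q - p + 1) / p) * (p / ((p - 1) * (q + 1))) powr (1 / p)"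
  assumes q: "q > p - 1" and p: "p > 1" and s: "s \<in> {1, -1}"
    and r0: "r0 > 0" "0 < u r0"
    and u_deriv: "\<And>r. r > 0 \<Longrightarrow>
      (u has_real_derivative E * r powr (- (N - 1) / (p - 1))) (at r)"
  shows "gives_positive_solutions N p q u (p / (q - p + 1))"
proof -
  define k where "k = p / (q - p + 1)"
  define B where "B = (p / ((p - 1) * (q + 1))) powr (1 / p)"
  have pos: "q - p + 1 > 0" "q + 1 > 0" "p - 1 > 0" "p > 0"
    using p q by auto
  have B: "B > 0" "B powr p = p / ((p - 1) * (q + 1))"
    using pos by (auto simp: B_def powr_powr)
  have k: "k > 0" "(k + 1) * (p - 1) + 1 = k * q"
    using pos by (auto simp: k_def field_simps)
  have k1: "k + 1 = k * (q + 1) / p"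
    using pos by (simp add: k_def divide_simps)
  have kE: "k * E = s * B"
    using pos by (simp add: k_def E_def B_def)
  have "flux p s = s"
    using s by (auto simp: flux_def)
  then have "flux p (k * E) * (k * E) = s * s * (B powr (p - 1) * B)"
    by (simp add: kE flux_mult flux_pos[OF B(1)])
  also have "\<dots> = B powr p"
    using s B(1) powr_mult_base[of B "p - 1"] by (auto simp: mult.commute)
  finally have "k * (flux p (k * E) * E) = p / ((p - 1) * (q + 1))"
    by (simp add: B(2) algebra_simps)
  moreover have "(k + 1) * (p - 1) * (flux p (k * E) * E)
      = (q + 1) / p * (p - 1) * (k * (flux p (k * E) * E))"
    unfolding k1 by simp
  ultimately have "(k + 1) * (p - 1) * (flux p (k * E) * E)
      = (q + 1) / p * (p - 1) * (p / ((p - 1) * (q + 1)))"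
    by simp
  also have "\<dots> = 1"
    using pos by simp
  finally have E: "(k + 1) * (p - 1) * (flux p (k * E) * E) = 1" .
  have "positive_solution_on N p q I (\<lambda>r. u r powr (- k))"
    if I: "nondegenerate_interval I" and "\<forall>r\<in>I. 0 < u r" for I
  proof (rule negative_power_of_p_harmonic_solves[OF p k(2) E I])
    fix r
    assume "r \<in> I"
    then show "0 < u r"
      using that by blast
    have "0 < r"
      using I \<open>r \<in> I\<close> by (auto simp: nondegenerate_interval_def)
    then show "(u has_real_derivative E * r powr (- (N - 1) / (p - 1))) (at r within I)"
      by (rule has_field_derivative_at_within[OF u_deriv])
  qed
  moreover have "\<exists>I. nondegenerate_interval I \<and> (\<forall>r\<in>I. 0 < u r)"
    using positive_near_point_interval[of r0 u] r0 DERIV_isCont[OF u_deriv[OF r0(1)]] by blast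
  ultimately show ?thesis
    by (simp add: gives_positive_solutions_def k_def)
qed

theorem theorem4p17:
  fixes N p q :: real
  assumes "q > p - 1" and "p - 1 > 0"
  shows "(p \<noteq> N \<longrightarrow> (\<forall>c>0. \<forall>s\<in>{1, -1}.
            gives_positive_solutions N p q
              (\<lambda>r. c + s * d_pqN p q N * r powr ((p - N) / (p - 1)))
              (p / (q - p + 1)))) \<and>
         (p = N \<longrightarrow> (\<forall>c>0. \<forall>s\<in>{1, -1}.
            gives_positive_solutions N p q
              (\<lambda>r. c + s * d_N q N * ln r)
              (N / (q - N + 1))))"
proof (intro conjI impI allI ballI)
  fix c s :: real
  assume "p \<noteq> N" "0 < c" and s: "s \<in> {1, -1}"
  define a where "a = (p - N) / (p - 1)"
  define d where "d = d_pqN p q N"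
  define x where "x = c / (2 * (\<bar>d\<bar> + 1))"
  have a: "a \<noteq> 0" "a - 1 = - (N - 1) / (p - 1)"
    using assms \<open>p \<noteq> N\<close> by (auto simp: a_def field_simps)
  have "x > 0"
    using \<open>0 < c\<close> by (simp add: x_def)
  \<comment> \<open>At the point where \<open>r powr a = x\<close> the second summand is at most \<open>c / 2\<close> in modulus.\<close>
  have x: "x powr (1 / a) > 0" "(x powr (1 / a)) powr a = x"
    using a \<open>x > 0\<close> by (simp_all add: powr_powr)
  have "\<bar>d * x\<bar> < c"
  proof -
    have "\<bar>d * x\<bar> = \<bar>d\<bar> * x"
      using \<open>x > 0\<close> by (simp add: abs_mult)
    also have "\<dots> \<le> (\<bar>d\<bar> + 1) * x"
      using \<open>x > 0\<close> by (simp add: distrib_right)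
    also have "\<dots> = c / 2"
    proof -
      have "\<bar>d\<bar> + 1 \<noteq> 0"
        by linarith
      then show ?thesis
        by (simp only: x_def) (simp add: divide_simps)
    qed
    finally show ?thesis
      using \<open>0 < c\<close> by simp
  qed
  then have "0 < c + s * d * x"
    using s by auto
  then have "0 < c + s * d * (x powr (1 / a)) powr a"
    by (simp add: x)
  moreover have "s * d * a = s * ((q - p + 1) / p) * (p / ((p - 1) * (q + 1))) powr (1 / p)"
    using assms \<open>p \<noteq> N\<close> by (simp add: d_def d_pqN_def a_def)
  then have "((\<lambda>r. c + s * d * r powr a) has_real_derivative
      s * ((q - p + 1) / p) * (p / ((p - 1) * (q + 1))) powr (1 / p)
        * r powr (- (N - 1) / (p - 1))) (at r)" if "r > 0" for r
    using DERIV_add[OF DERIV_const DERIV_cmult[OF has_real_derivative_powr[OF that, of a], of "s * d"]]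
    by (simp add: a(2) flip: mult.assoc)
  ultimately show "gives_positive_solutions N p q
      (\<lambda>r. c + s * d_pqN p q N * r powr ((p - N) / (p - 1))) (p / (q - p + 1))"
    unfolding a_def[symmetric] d_def[symmetric] using assms s x(1)
    by (intro gives_positive_solutions_of_slope[where s = s and ?r0.0 = "x powr (1 / a)"]) auto
next
  fix c s :: real
  assume "p = N" "0 < c" and s: "s \<in> {1, -1}"
  have "((\<lambda>r. c + s * d_N q N * ln r) has_real_derivative
      s * ((q - N + 1) / N) * (N / ((N - 1) * (q + 1))) powr (1 / N)
        * r powr (- (N - 1) / (N - 1))) (at r)" if "r > 0" for r
  proof -
    have "- (N - 1) / (N - 1) = - 1"
      using assms \<open>p = N\<close> by (simp add: divide_eq_minus_1_iff)
    then have "r powr (- (N - 1) / (N - 1)) = 1 / r"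
      using that by (simp only: powr_minus_divide) simp
    moreover have "((\<lambda>r. c + s * d_N q N * ln r) has_real_derivative s * d_N q N * (1 / r)) (at r)"
      using that by (auto intro!: derivative_eq_intros)
    ultimately show ?thesis
      by (simp add: d_N_def mult.assoc)
  qed
  then show "gives_positive_solutions N p q (\<lambda>r. c + s * d_N q N * ln r) (N / (q - N + 1))"
    unfolding \<open>p = N\<close> using assms \<open>p = N\<close> \<open>0 < c\<close> s
    by (intro gives_positive_solutions_of_slope[where s = s and ?r0.0 = 1]) auto
qed

end
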